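(* Let $P$ be a $d$-dimensional simple polytope ($d\ge 1$) with $n\ge d+1$ vertices, equipped with an abstract objective function (in particular, this covers generic linear objective functions), and let $s$ be any vertex of $P$. Then the expected number of vertices visited by the Random-Edge simplex algorithm started at $s$ is at most $$13\cdot\frac{n}{\sqrt{d}}.$$
   Context: A $d$-dimensional polytope is simple if every vertex lies in exactly $d$ facets. Let $V$ be the vertex set of $P$. An acyclic unique sink orientation (AUSO) of $P$ is a directed graph $D=(V,A)$ such that (i) its underlying undirected graph is the vertex-edge graph of $P$, (ii) $D$ is acyclic, and (iii) for every nonempty face $F$ of $P$, the subgraph of $D$ induced by the vertices of $F$ has a unique sink. A function $\varphi:V\to\mathbb{R}$ is generic if $\varphi(v)\ne\varphi(w)$ whenever $v,w$ are adjacent; it induces the orientation with arc $v\to w$ for adjacent $v,w$ with $\varphi(v)>\varphi(w)$. An abstract objective function is a generic function $\varphi:V\to\mathbb{R}$ whose induced orientation is an AUSO (every generic linear function is one). The Random-Edge simplex algorithm started at $s$ performs the random walk on $D$ which, at each visited vertex other than the global sink $v_{\mathrm{opt}}$ of $D$, moves along an outgoing arc chosen uniformly at random (independently of the past) among all arcs leaving the current vertex, and stops at $v_{\mathrm{opt}}$. The number of visited vertices is the number of vertices on the resulting random directed path from $s$ to $v_{\mathrm{opt}}$ (both endpoints included). *)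

theory Defs
  imports "HOL-Analysis.Polytope" "HOL-Probability.SPMF"
begin

definition vertices :: "'a::euclidean_space set \<Rightarrow> 'a set" where
  "vertices P = {v. v extreme_point_of P}"

definition simple_polytope :: "'a::euclidean_space set \<Rightarrow> bool" where
  "simple_polytope P \<longleftrightarrow> polytope P \<and>
     (\<forall>v\<in>vertices P. int (card {F. F facet_of P \<and> v \<in> F}) = aff_dim P)"

text \<open>The vertex-edge graph, as a symmetric relation. It is irreflexive because
  \<open>edge_of\<close> requires affine dimension 1.\<close>

definition vertex_edge_graph :: "'a::euclidean_space set \<Rightarrow> ('a \<times> 'a) set" where
  "vertex_edge_graph P =
     {(v, w). v \<in> vertices P \<and> w \<in> vertices P \<and> closed_segment v w edge_of P}"

text \<open>\<open>v\<close> is a sink of the subgraph of \<open>D\<close> induced by \<open>U\<close>.\<close>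

definition is_sink :: "('a \<times> 'a) set \<Rightarrow> 'a set \<Rightarrow> 'a \<Rightarrow> bool" where
  "is_sink D U v \<longleftrightarrow> v \<in> U \<and> (\<forall>w\<in>U. (v, w) \<notin> D)"

definition auso :: "'a::euclidean_space set \<Rightarrow> ('a \<times> 'a) set \<Rightarrow> bool" where
  "auso P D \<longleftrightarrow>
     D \<union> D\<inverse> = vertex_edge_graph P \<and>
     acyclic D \<and>
     (\<forall>F. F face_of P \<and> F \<noteq> {} \<longrightarrow> (\<exists>!v. is_sink D (vertices F) v))"

text \<open>Only the values of \<open>\<phi>\<close> on the vertices of \<open>P\<close> matter below.\<close>

definition generic :: "'a::euclidean_space set \<Rightarrow> ('a \<Rightarrow> real) \<Rightarrow> bool" where
  "generic P \<phi> \<longleftrightarrow> (\<forall>(v, w) \<in> vertex_edge_graph P. \<phi> v \<noteq> \<phi> w)"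

definition induced_orientation ::
    "'a::euclidean_space set \<Rightarrow> ('a \<Rightarrow> real) \<Rightarrow> ('a \<times> 'a) set" where
  "induced_orientation P \<phi> = {(v, w) \<in> vertex_edge_graph P. \<phi> v > \<phi> w}"

definition abstract_objective_function ::
    "'a::euclidean_space set \<Rightarrow> ('a \<Rightarrow> real) \<Rightarrow> bool" where
  "abstract_objective_function P \<phi> \<longleftrightarrow> generic P \<phi> \<and> auso P (induced_orientation P \<phi>)"

text \<open>Distribution of the random directed path, as the list of visited vertices. In an AUSO the
  only vertex without leaving arcs is the global sink, so the walk stops exactly there. Any mass
  missing from the subprobability distribution would correspond to non-termination; the lemma
  below shows that there is none for finite acyclic digraphs.\<close>

partial_function (spmf) random_edge_path :: "('a \<times> 'a) set \<Rightarrow> 'a \<Rightarrow> 'a list spmf" where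
  "random_edge_path D v =
     (if D `` {v} = {} then return_spmf [v]
      else bind_spmf (spmf_of_set (D `` {v})) (\<lambda>w. map_spmf ((#) v) (random_edge_path D w)))"

lemma lossless_random_edge_path:
  assumes "finite D" and "acyclic D"
  shows "lossless_spmf (random_edge_path D s)"
proof -
  have wf: "wf (D\<inverse>)"
    using assms by (rule finite_acyclic_wf_converse)
  have fin: "finite (D `` {v})" for v
    using assms(1) by (rule finite_Image)
  show ?thesis
  proof (induction s rule: wf_induct_rule[OF wf])
    case (1 v)
    show ?case
      using 1 fin[of v] by (subst random_edge_path.simps) (auto simp: lossless_bind_spmf)
  qed
qed

end

theory Submission
  imports Defs
begin

text \<open>
  The walk is slow only where few arcs leave a vertex, and a simple polytope has few such vertices.

  Rank the vertices by the objective. From a vertex with more than \<open>k\<close> leaving arcs a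
  random step skips about \<open>k / 2\<close> ranks or more in expectation, so such vertices account for
  \<open>2 * n / (k + 2)\<close> visits at most. The remaining vertices, those with at most \<open>k\<close> leaving arcs, are
  visited at most once each. Both contributions are handled by one potential function in
  \<open>expected_visits_le_of_few_small_outdegrees\<close>.

  To bound the number of vertices with at most \<open>k\<close> leaving arcs, consider faces of dimension \<open>k\<close>. At a
  vertex of a simple polytope the faces correspond to sets of facets
  (\<open>bij_betw_faces_through_simple_vertex\<close>), so every vertex lies in exactly \<open>d choose k\<close> of them. If
  \<open>2 * k\<^sup>2 \<le> d\<close> and at most \<open>k\<close> arcs leave \<open>v\<close>, then at least half of the faces through \<open>v\<close> contain none
  of these arcs, and \<open>v\<close> is their sink. As a face has one sink but at least \<open>k + 1\<close> vertices, double
  counting shows that there are at most \<open>2 * n / (k + 1)\<close> such vertices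
  (\<open>card_small_outdegree_vertices_le\<close>).

  With \<open>k\<close> the integer part of \<open>sqrt (d / 2)\<close> the two contributions add up to at most
  \<open>4 * n / (k + 1)\<close>, which is less than \<open>8 * n / sqrt d\<close>.
\<close>

section \<open>Random walks on acyclic digraphs\<close>

lemma nn_integral_bind_spmf:
  "(\<integral>\<^sup>+ x. f x \<partial>measure_spmf (bind_spmf p g))
     = (\<integral>\<^sup>+ y. \<integral>\<^sup>+ x. f x \<partial>measure_spmf (g y) \<partial>measure_spmf p)"
proof -
  have "measure_spmf \<circ> g \<in> measurable (measure_spmf p) (subprob_algebra (count_space UNIV))"
    by (auto simp: space_subprob_algebra)
  from nn_integral_bind[OF _ this, of f] show ?thesis
    by (simp add: measure_spmf_bind)
qed

abbreviation expected_visits :: "('a \<times> 'a) set \<Rightarrow> 'a \<Rightarrow> ennreal" where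
  "expected_visits D v \<equiv> \<integral>\<^sup>+ p. of_nat (length p) \<partial>measure_spmf (random_edge_path D v)"

lemma expected_visits_sink: "D `` {v} = {} \<Longrightarrow> expected_visits D v = 1"
  by (subst random_edge_path.simps) (simp add: measure_spmf_return_spmf nn_integral_return)

lemma expected_visits_step:
  assumes "D `` {v} \<noteq> {}" "finite (D `` {v})"
  shows "expected_visits D v
           \<le> 1 + (\<Sum>w\<in>D `` {v}. expected_visits D w) / of_nat (card (D `` {v}))"
proof -
  have cons: "(\<integral>\<^sup>+ p. of_nat (length p) \<partial>measure_spmf (map_spmf ((#) v) q))
      \<le> 1 + (\<integral>\<^sup>+ p. of_nat (length p) \<partial>measure_spmf q)" for q :: "'a list spmf"
    by (simp add: o_def nn_integral_add measure_spmf.emeasure_space_le_1 add_right_mono)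
  have "expected_visits D v
      = (\<integral>\<^sup>+ w. \<integral>\<^sup>+ p. of_nat (length p) \<partial>measure_spmf (map_spmf ((#) v) (random_edge_path D w))
           \<partial>measure_spmf (spmf_of_set (D `` {v})))"
    using assms by (subst random_edge_path.simps) (simp add: nn_integral_bind_spmf del: nn_integral_map_spmf)
  also have "\<dots> \<le> (\<integral>\<^sup>+ w. 1 + expected_visits D w \<partial>measure_spmf (spmf_of_set (D `` {v})))"
    by (intro nn_integral_mono cons)
  also have "\<dots> \<le> 1 + (\<integral>\<^sup>+ w. expected_visits D w \<partial>measure_spmf (spmf_of_set (D `` {v})))"
    by (simp add: nn_integral_add measure_spmf.emeasure_space_le_1 add_right_mono)
  finally show ?thesis by (simp add: nn_integral_spmf_of_set)
qed

text \<open>The expected number of visits solves, on an acyclic digraph, a system of equations that can be read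
  from the sink upwards, so any supersolution dominates it. At the sink the average is
  \<open>0 / 0 = 0\<close>, and the hypothesis on \<open>g\<close> becomes \<open>1 \<le> g v\<close> there.\<close>

lemma expected_visits_le_potential:
  fixes g :: "'a \<Rightarrow> real"
  assumes D: "finite D" "acyclic D" and closed: "D `` V \<subseteq> V"
    and g: "\<And>v. v \<in> V \<Longrightarrow> 1 + (\<Sum>w\<in>D `` {v}. g w) / real (card (D `` {v})) \<le> g v"
    and s: "s \<in> V"
  shows "expected_visits D s \<le> ennreal (g s)"
proof -
  have wf: "wf (D\<inverse>)"
    using D by (rule finite_acyclic_wf_converse)
  have "0 \<le> g s \<and> expected_visits D s \<le> ennreal (g s)"
    using s
  proof (induction s rule: wf_induct_rule[OF wf])
    case (1 v)
    let ?W = "D `` {v}"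
    have fin: "finite ?W" using D(1) by (rule finite_Image)
    have IH: "0 \<le> g w" "expected_visits D w \<le> ennreal (g w)" if "w \<in> ?W" for w
      using 1 that closed by blast+
    have nonneg: "0 \<le> (\<Sum>w\<in>?W. g w) / real (card ?W)"
      using IH(1) by (intro divide_nonneg_nonneg sum_nonneg) auto
    have "expected_visits D v \<le> ennreal (1 + (\<Sum>w\<in>?W. g w) / real (card ?W))"
    proof (cases "?W = {}")
      case True
      then show ?thesis by (simp add: expected_visits_sink)
    next
      case False
      have "expected_visits D v \<le> 1 + (\<Sum>w\<in>?W. expected_visits D w) / of_nat (card ?W)"
        using expected_visits_step[OF False fin] .
      also have "\<dots> \<le> 1 + (\<Sum>w\<in>?W. ennreal (g w)) / of_nat (card ?W)"
        using IH(2) by (intro add_left_mono divide_right_mono_ennreal sum_mono) auto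
      also have "(\<Sum>w\<in>?W. ennreal (g w)) = ennreal (\<Sum>w\<in>?W. g w)"
        using IH(1) by (intro sum_ennreal) auto
      also have "1 + \<dots> / of_nat (card ?W) = ennreal (1 + (\<Sum>w\<in>?W. g w) / real (card ?W))"
      proof -
        have "0 \<le> (\<Sum>w\<in>?W. g w)" using IH(1) by (intro sum_nonneg) auto
        moreover have "0 < real (card ?W)" using False fin by (simp add: card_gt_0_iff)
        ultimately have "ennreal (\<Sum>w\<in>?W. g w) / of_nat (card ?W)
            = ennreal ((\<Sum>w\<in>?W. g w) / real (card ?W))"
          by (simp only: ennreal_of_nat_eq_real_of_nat divide_ennreal)
        then show ?thesis
          using nonneg by (simp add: ennreal_plus flip: ennreal_1)
      qed
      finally show ?thesis .
    qed
    then show ?case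
      using g[OF 1(2)] nonneg by (meson add_nonneg_nonneg ennreal_leI order_trans zero_le_one)
  qed
  then show ?thesis ..
qed

text \<open>The extreme case is \<open>A = {m - card A..<m}\<close>: distinct numbers below \<open>m\<close> stay below \<open>m\<close> by
  \<open>(card A + 1) / 2\<close> on average.\<close>

lemma sum_distinct_below_le:
  assumes "finite A" "\<And>a. a \<in> A \<Longrightarrow> a < (m::nat)"
  shows "2 * \<Sum>A + card A * (card A + 1) \<le> 2 * card A * m"
  using assms
proof (induction A arbitrary: m rule: finite_linorder_max_induct)
  case (insert b A)
  have b: "b \<notin> A" using insert by blast
  have "2 * \<Sum>(insert b A) + card (insert b A) * (card (insert b A) + 1)
      = (2 * \<Sum>A + card A * (card A + 1)) + 2 * (b + card A + 1)"
    using insert b by (simp add: algebra_simps)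
  also have "\<dots> \<le> 2 * card A * b + 2 * (b + card A + 1)"
    using insert.IH[of b] insert.hyps(2) by (intro add_right_mono) blast
  also have "\<dots> = 2 * card (insert b A) * (b + 1)"
    using insert b by (simp add: algebra_simps)
  also have "\<dots> \<le> 2 * card (insert b A) * m"
    using insert.prems[of b] by (intro mult_le_mono2) simp
  finally show ?case .
qed simp

text \<open>The neighbours of a vertex need not have distinct objective values. Breaking ties turns the
  objective into a ranking with distinct values, for which the previous inequality applies.\<close>

lemma exists_ranking:
  fixes \<phi> :: "'a \<Rightarrow> 'b::linorder"
  assumes "finite V"
  shows "\<exists>\<psi>. inj_on \<psi> V \<and> (\<forall>v\<in>V. \<psi> v < card V) \<and> (\<forall>v\<in>V. \<forall>w\<in>V. \<phi> v < \<phi> w \<longrightarrow> \<psi> v < \<psi> w)"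
  using assms
proof (induction V rule: finite_ranking_induct[where f = \<phi>])
  case (insert x V)
  then obtain \<psi> where \<psi>: "inj_on \<psi> V" "\<forall>v\<in>V. \<psi> v < card V"
      "\<forall>v\<in>V. \<forall>w\<in>V. \<phi> v < \<phi> w \<longrightarrow> \<psi> v < \<psi> w"
    by blast
  show ?case
  proof (cases "x \<in> V")
    case True
    then show ?thesis using \<psi> by (auto simp: insert_absorb)
  next
    case False
    let ?\<psi> = "\<psi>(x := card V)"
    have card: "card (insert x V) = Suc (card V)"
      using insert(1) False by simp
    have old: "?\<psi> v = \<psi> v" "\<psi> v < card V" if "v \<in> V" for v
      using that \<psi>(2) False by auto
    have "inj_on ?\<psi> (insert x V)"
    proof (rule inj_onI)
      fix v w assume "v \<in> insert x V" "w \<in> insert x V" "?\<psi> v = ?\<psi> w"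
      then show "v = w"
        using inj_onD[OF \<psi>(1), of v w] \<psi>(2) False by (auto split: if_splits)
    qed
    moreover have "?\<psi> v < card (insert x V)" if "v \<in> insert x V" for v
      using that old[of v] card by (cases "v = x") auto
    moreover have "?\<psi> v < ?\<psi> w" if "v \<in> insert x V" "w \<in> insert x V" "\<phi> v < \<phi> w" for v w
    proof -
      have "v \<noteq> x"
        using that(2,3) insert(2)[of w] by auto
      then show ?thesis
        using that \<psi>(2,3) by (cases "w = x") auto
    qed
    ultimately show ?thesis by blast
  qed
qed auto

text \<open>A step out of a vertex with \<open>m\<close> leaving arcs lowers the rank by at least \<open>(m + 1) / 2\<close> on average,
  because the \<open>m\<close> heads have distinct ranks. As there are only \<open>card V\<close> ranks to lose, vertices of
  out-degree above \<open>k\<close> are visited at most \<open>2 * card V / (k + 2)\<close> times in expectation; the other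
  vertices are visited at most once each.\<close>

lemma expected_visits_le_of_few_small_outdegrees:
  fixes \<phi> :: "'a \<Rightarrow> 'b::linorder" and k :: nat
  assumes V: "finite V" "D \<subseteq> V \<times> V" and \<phi>: "\<And>v w. (v, w) \<in> D \<Longrightarrow> \<phi> w < \<phi> v" and s: "s \<in> V"
  shows "expected_visits D s
           \<le> ennreal (real (card {v \<in> V. card (D `` {v}) \<le> k}) + 2 * real (card V) / real (k + 2))"
proof -
  obtain \<psi> :: "'a \<Rightarrow> nat" where inj: "inj_on \<psi> V" and bound: "\<And>v. v \<in> V \<Longrightarrow> \<psi> v < card V"
    and mono: "\<And>v w. v \<in> V \<Longrightarrow> w \<in> V \<Longrightarrow> \<phi> v < \<phi> w \<Longrightarrow> \<psi> v < \<psi> w"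
    using exists_ranking[OF V(1), of \<phi>] by metis
  have down: "\<psi> w < \<psi> v" "v \<in> V" "w \<in> V" if "(v, w) \<in> D" for v w
    using that V(2) \<phi>[OF that] mono by auto
  have finD: "finite D"
    using V finite_subset by blast
  have "D \<subseteq> (inv_image less_than \<psi>)\<inverse>" using down by auto
  then have "acyclic D"
    by (meson acyclic_converse acyclic_subset wf_acyclic wf_inv_image wf_less_than)
  define L where "L v = {u \<in> V. card (D `` {u}) \<le> k \<and> \<psi> u \<le> \<psi> v}" for v
  \<comment> \<open>What is left to pay at \<open>v\<close>: one visit for each vertex of small out-degree not ranked above \<open>v\<close>,
    and \<open>2 / (k + 2)\<close> visits for each remaining rank.\<close>
  define g where "g v = real (card (L v)) + 2 * real (\<psi> v + 1) / real (k + 2)" for v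
  have finL: "finite (L v)" for v using V(1) by (simp add: L_def)
  have "1 + (\<Sum>w\<in>D `` {v}. g w) / real (card (D `` {v})) \<le> g v" if v: "v \<in> V" for v
  proof -
    let ?W = "D `` {v}"
    have finW: "finite ?W" using finD by (rule finite_Image)
    have inL: "v \<in> L v" if "card ?W \<le> k"
      using that v by (simp add: L_def)
    have Lsub: "L w \<subseteq> L v - {v}" if "w \<in> ?W" for w
      using that down[of v w] by (auto simp: L_def)
    show ?thesis
    proof (cases "?W = {}")
      case True
      then have "1 \<le> card (L v)"
        using inL finL[of v] by (simp add: Suc_le_eq card_gt_0_iff) blast
      then have "1 \<le> real (card (L v))" by simp
      moreover have "0 \<le> 2 * real (\<psi> v + 1) / real (k + 2)" by simp
      ultimately have "1 \<le> g v" unfolding g_def by linarith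
      then show ?thesis using True by simp
    next
      case False
      let ?m = "card ?W"
      have m: "?m > 0" using False finW by (simp add: card_gt_0_iff)
      have "(\<Sum>w\<in>?W. g w) \<le> real ?m * (g v - 1)"
      proof (cases "?m \<le> k")
        case True
        \<comment> \<open>The visit to \<open>v\<close> is paid by \<open>v\<close> itself, which no head of a leaving arc has below it.\<close>
        have "g w \<le> g v - 1" if w: "w \<in> ?W" for w
        proof -
          have "card (L w) \<le> card (L v - {v})"
            using Lsub[OF w] finL by (intro card_mono) auto
          also have "\<dots> < card (L v)"
            using inL[OF True] finL by (intro card_Diff1_less) auto
          finally have "real (card (L w)) \<le> real (card (L v)) - 1" by simp
          moreover have "2 * real (\<psi> w + 1) / real (k + 2) \<le> 2 * real (\<psi> v + 1) / real (k + 2)"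
            using down[of v w] w by (intro divide_right_mono) auto
          ultimately show ?thesis by (simp add: g_def)
        qed
        then show ?thesis
          using sum_mono[of ?W g "\<lambda>_. g v - 1"] by simp
      next
        case False
        \<comment> \<open>Here the ranks that the step skips pay for the visit.\<close>
        have "inj_on \<psi> ?W"
          using inj down by (meson Image_singleton_iff inj_on_subset subsetI)
        then have "\<Sum>(\<psi> ` ?W) = (\<Sum>w\<in>?W. \<psi> w)" "card (\<psi> ` ?W) = ?m"
          by (simp_all add: sum.reindex card_image)
        then have "2 * (\<Sum>w\<in>?W. \<psi> w) + ?m * (?m + 1) \<le> 2 * ?m * \<psi> v"
          using sum_distinct_below_le[of "\<psi> ` ?W" "\<psi> v"] down finW by auto
        then have "real (2 * (\<Sum>w\<in>?W. \<psi> w) + ?m * (?m + 1)) \<le> real (2 * ?m * \<psi> v)"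
          by (rule of_nat_mono)
        moreover have "real ?m * real (k + 2) \<le> real ?m * real (?m + 1)"
          using False by (intro mult_left_mono) auto
        ultimately have skip: "2 * (\<Sum>w\<in>?W. real (\<psi> w + 1)) \<le> real ?m * (2 * real (\<psi> v + 1) - real (k + 2))"
          by (simp add: sum.distrib algebra_simps)
        have "(\<Sum>w\<in>?W. g w)
            = (\<Sum>w\<in>?W. real (card (L w))) + 2 * (\<Sum>w\<in>?W. real (\<psi> w + 1)) / real (k + 2)"
          unfolding g_def sum.distrib by (simp add: sum_distrib_left sum_divide_distrib)
        also have "\<dots> \<le> (\<Sum>w\<in>?W. real (card (L v)))
            + real ?m * (2 * real (\<psi> v + 1) - real (k + 2)) / real (k + 2)"
          using Lsub finL skip
          by (intro add_mono sum_mono divide_right_mono of_nat_mono card_mono) auto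
        also have "\<dots> = real ?m * (g v - 1)"
          by (simp add: g_def field_simps)
        finally show ?thesis .
      qed
      then show ?thesis using m by (simp add: field_simps)
    qed
  qed
  then have "expected_visits D s \<le> ennreal (g s)"
    using V(2) by (intro expected_visits_le_potential[OF finD \<open>acyclic D\<close> _ _ s]) auto
  also have "g s \<le> real (card {v \<in> V. card (D `` {v}) \<le> k}) + 2 * real (card V) / real (k + 2)"
    unfolding g_def using V(1) bound[OF s]
    by (intro add_mono divide_right_mono of_nat_mono card_mono) (auto simp: L_def)
  finally show ?thesis by (simp add: ennreal_leI)
qed

section \<open>Faces at a vertex of a simple polytope\<close>

definition facets_containing :: "'a::euclidean_space set \<Rightarrow> 'a set \<Rightarrow> 'a set set" where
  "facets_containing P F = {G. G facet_of P \<and> F \<subseteq> G}"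

lemma finite_facets_containing: "polytope P \<Longrightarrow> finite (facets_containing P F)"
  unfolding facets_containing_def by (rule finite_subset[OF _ finite_polytope_facets]) auto

lemma face_eq_Int_facets_containing:
  assumes "polytope P" "F face_of P" "F \<noteq> {}"
  shows "F = P \<inter> \<Inter>(facets_containing P F)"
proof (cases "F = P")
  case True
  then show ?thesis by (auto simp: facets_containing_def)
next
  case False
  have "F = \<Inter>{G. G facet_of P \<and> F \<subseteq> G}"
    using face_of_polyhedron[OF polytope_imp_polyhedron[OF assms(1)] assms(2,3) False] .
  then show ?thesis
    using face_of_imp_subset[OF assms(2)] unfolding facets_containing_def by auto
qed

lemma face_subset_iff_facets_containing:
  assumes "polytope P" "F face_of P" "F \<noteq> {}" "G face_of P" "G \<noteq> {}"
  shows "F \<subseteq> G \<longleftrightarrow> facets_containing P G \<subseteq> facets_containing P F"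
proof
  show "facets_containing P G \<subseteq> facets_containing P F" if "F \<subseteq> G"
    using that by (auto simp: facets_containing_def)
  show "F \<subseteq> G" if "facets_containing P G \<subseteq> facets_containing P F"
    using that face_eq_Int_facets_containing[OF assms(1-3)]
      face_eq_Int_facets_containing[OF assms(1,4,5)] by blast
qed

lemma inj_on_facets_containing:
  assumes "polytope P"
  shows "inj_on (facets_containing P) {F. F face_of P \<and> F \<noteq> {}}"
proof (rule inj_onI)
  fix F G
  assume F: "F \<in> {F. F face_of P \<and> F \<noteq> {}}" and G: "G \<in> {F. F face_of P \<and> F \<noteq> {}}"
    and eq: "facets_containing P F = facets_containing P G"
  have "F = P \<inter> \<Inter>(facets_containing P F)"
    using F by (intro face_eq_Int_facets_containing[OF assms]) auto
  also have "\<dots> = P \<inter> \<Inter>(facets_containing P G)"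
    by (simp only: eq)
  also have "\<dots> = G"
    using G by (intro face_eq_Int_facets_containing[OF assms, symmetric]) auto
  finally show "F = G" .
qed

lemma obtain_facet_through_vertex:
  assumes "polytope F" "v extreme_point_of F" "aff_dim F \<ge> 1"
  obtains G where "G facet_of F" "v \<in> G"
proof -
  have "{v} face_of F" "{v} \<noteq> F"
    using assms by (auto simp: face_of_singleton)
  then show thesis
    using face_of_polyhedron_subset_facet[OF polytope_imp_polyhedron[OF assms(1)], of "{v}"] that
    by auto
qed

text \<open>A face is the intersection of the facets that contain it, so a ridge that lay in the single facet
  \<open>G\<close> would be equal to \<open>G\<close>. Intersecting \<open>G\<close> with a second facet through the ridge leaves a proper
  face of \<open>G\<close>, which has no room for more than the ridge.\<close>

lemma ridge_eq_Int_facets: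
  assumes "polytope P" "G facet_of P" "R facet_of G"
  obtains G' where "G' facet_of P" "G' \<noteq> G" "R = G \<inter> G'"
proof -
  have faces: "G face_of P" "R face_of G" "R \<noteq> {}" "R \<noteq> G"
    using assms(2,3) by (auto simp: facet_of_def)
  have "R face_of P"
    using faces face_of_trans by blast
  have "R \<subseteq> G" "G \<subseteq> P"
    using faces face_of_imp_subset by auto
  have "facets_containing P R \<noteq> facets_containing P G"
    using face_subset_iff_facets_containing[OF assms(1) \<open>G face_of P\<close> _ \<open>R face_of P\<close> \<open>R \<noteq> {}\<close>]
      \<open>R \<subseteq> G\<close> faces by blast
  moreover have "facets_containing P G \<subseteq> facets_containing P R"
    using \<open>R \<subseteq> G\<close> by (auto simp: facets_containing_def)
  ultimately obtain G' where G': "G' facet_of P" "R \<subseteq> G'" "\<not> G \<subseteq> G'"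
    by (auto simp: facets_containing_def)
  have GG: "G \<inter> G' face_of G"
    using G' faces \<open>G \<subseteq> P\<close>
    by (meson Int_lower1 face_of_Int face_of_subset facet_of_imp_face_of)
  have cG: "convex G" using GG face_of_imp_convex faces(1) by auto
  have "aff_dim (G \<inter> G') < aff_dim G"
    using face_of_aff_dim_lt[OF cG GG] G' by blast
  moreover have "aff_dim R = aff_dim G - 1"
    using assms(3) by (simp add: facet_of_def)
  moreover have "R face_of (G \<inter> G')"
    using face_of_subset[OF faces(2)] \<open>R \<subseteq> G\<close> G' by blast
  ultimately have "R = G \<inter> G'"
    using face_of_aff_dim_lt[of "G \<inter> G'" R] face_of_imp_convex[OF GG] cG by force
  then show thesis using that G' by blast
qed

text \<open>By induction on the dimension: a facet \<open>G\<close> through \<open>v\<close> has at least \<open>aff_dim F - 1\<close> facets through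
  \<open>v\<close>, each of them cut out of \<open>G\<close> by another facet of \<open>F\<close> through \<open>v\<close>. Together with \<open>G\<close> itself
  these are enough. This replaces the usual argument with linearly independent normal vectors.\<close>

lemma aff_dim_le_card_facets_through_vertex:
  assumes "polytope F" "v extreme_point_of F"
  shows "aff_dim F \<le> int (card (facets_containing F {v}))"
  using assms
proof (induction "nat (aff_dim F)" arbitrary: F)
  case 0
  then show ?case by simp
next
  case (Suc j)
  obtain G where G: "G facet_of F" "v \<in> G"
    using obtain_facet_through_vertex[OF Suc.prems] Suc.hyps(2) by force
  have dimG: "aff_dim G = aff_dim F - 1" and faceG: "G face_of F"
    using G by (auto simp: facet_of_def)
  have polyG: "polytope G"
    using face_of_polytope_polytope Suc.prems(1) faceG by blast
  have "v extreme_point_of G"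
    using extreme_point_of_face[OF faceG] Suc.prems(2) G(2) by blast
  then have IH: "aff_dim G \<le> int (card (facets_containing G {v}))"
    using Suc.hyps(1)[OF _ polyG] Suc.hyps(2) dimG by simp
  have "\<exists>G'. G' facet_of F \<and> G' \<noteq> G \<and> R = G \<inter> G'" if "R facet_of G" for R
    using ridge_eq_Int_facets[OF Suc.prems(1) G(1) that] by metis
  then obtain h where h: "\<And>R. R facet_of G \<Longrightarrow> h R facet_of F \<and> h R \<noteq> G \<and> R = G \<inter> h R"
    by metis
  have inj: "inj_on h (facets_containing G {v})"
    by (rule inj_onI) (metis h facets_containing_def mem_Collect_eq)
  have sub: "insert G (h ` facets_containing G {v}) \<subseteq> facets_containing F {v}"
    using h G by (fastforce simp: facets_containing_def)
  have "card (insert G (h ` facets_containing G {v})) = Suc (card (facets_containing G {v}))"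
    using h inj finite_facets_containing[OF polyG, of "{v}"]
    by (subst card_insert_disjoint) (auto simp: card_image facets_containing_def)
  then have "Suc (card (facets_containing G {v})) \<le> card (facets_containing F {v})"
    using card_mono[OF finite_facets_containing[OF Suc.prems(1)] sub] by simp
  then show ?case using IH dimG by linarith
qed

lemma card_facets_through_simple_vertex:
  assumes "simple_polytope P" "v \<in> vertices P"
  shows "int (card (facets_containing P {v})) = aff_dim P"
  using assms by (simp add: simple_polytope_def facets_containing_def)

text \<open>Descend from \<open>F\<close> through faces containing \<open>v\<close>, one dimension at a time. Each step adds at
  least one facet of \<open>P\<close>, and simplicity allows only \<open>aff_dim P\<close> of them in total at \<open>v\<close>.\<close>

lemma card_facets_containing_le_codim:
  assumes "simple_polytope P" "v \<in> vertices P" "F face_of P" "v \<in> F"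
  shows "int (card (facets_containing P F)) \<le> aff_dim P - aff_dim F"
  using assms(3,4)
proof (induction "nat (aff_dim F)" arbitrary: F)
  case 0
  have "aff_dim F = 0"
    using 0 aff_dim_negative_iff[of F] by (metis empty_iff linorder_not_le nat_0_iff antisym)
  then obtain a where "F = {a}"
    using aff_dim_eq_0 by metis
  then have "F = {v}"
    using 0(3) by simp
  then show ?case
    using card_facets_through_simple_vertex[OF assms(1,2)] by simp
next
  case (Suc j)
  have polyP: "polytope P" using assms(1) by (simp add: simple_polytope_def)
  have polyF: "polytope F"
    using face_of_polytope_polytope polyP Suc.prems(1) by blast
  have "v extreme_point_of F"
    using extreme_point_of_face[OF Suc.prems(1)] assms(2) Suc.prems(2)
    by (simp add: vertices_def)
  then obtain G where G: "G facet_of F" "v \<in> G"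
    using obtain_facet_through_vertex[OF polyF] Suc.hyps(2)  by force
  have dimG: "aff_dim G = aff_dim F - 1" and faceG: "G face_of P"
    using G Suc.prems(1) face_of_trans by (auto simp: facet_of_def)
  have IH: "int (card (facets_containing P G)) \<le> aff_dim P - aff_dim G"
    using Suc.hyps(1)[OF _ faceG G(2)] Suc.hyps(2) dimG by simp
  have "G \<subset> F"
    using G facet_of_imp_subset facet_of_irrefl by blast
  then have "facets_containing P F \<subset> facets_containing P G"
    using face_subset_iff_facets_containing[OF polyP] faceG Suc.prems G(2) by blast
  then have "card (facets_containing P F) < card (facets_containing P G)"
    by (simp add: finite_facets_containing[OF polyP] psubset_card_mono)
  then show ?case using IH dimG by linarith
qed

text \<open>At a simple vertex no set of facets meets in a face that is too small. Inductively, let \<open>F\<close> be the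
  face of \<open>T\<close>. By the previous bound a facet of \<open>F\<close> through \<open>v\<close> is contained in exactly the
  facets in \<open>insert i T\<close> for some \<open>i\<close> outside \<open>T\<close>; there are \<open>aff_dim F\<close> such sets and at least as many facets of \<open>F\<close> through \<open>v\<close>, so
  every \<open>i\<close> occurs.\<close>

lemma facets_through_simple_vertex_span_face:
  assumes simple: "simple_polytope P" and v: "v \<in> vertices P"
    and T: "T \<subseteq> facets_containing P {v}"
  shows "\<exists>F. F face_of P \<and> v \<in> F \<and> facets_containing P F = T \<and> aff_dim F = aff_dim P - int (card T)"
proof -
  have polyP: "polytope P" using simple by (simp add: simple_polytope_def)
  let ?A = "facets_containing P {v}"
  have finA: "finite ?A" using finite_facets_containing[OF polyP] .
  then have "finite T" using T finite_subset by blast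
  then show ?thesis using T
  proof (induction T rule: finite_induct)
    case empty
    have "facets_containing P P = {}"
      using facet_of_imp_subset[of _ P] by (force simp: facets_containing_def)
    moreover have "v \<in> P" using v by (auto simp: vertices_def extreme_point_of_def)
    ultimately show ?case
      using face_of_refl[OF polytope_imp_convex[OF polyP]] by auto
  next
    case (insert g T)
    then obtain F where F: "F face_of P" "v \<in> F" "facets_containing P F = T"
        "aff_dim F = aff_dim P - int (card T)"
      by auto
    have polyF: "polytope F"
      using face_of_polytope_polytope polyP F(1) by blast
    have "v extreme_point_of F"
      using extreme_point_of_face[OF F(1)] v F(2) by (simp add: vertices_def)
    then have many: "aff_dim F \<le> int (card (facets_containing F {v}))"
      using aff_dim_le_card_facets_through_vertex[OF polyF] by blast
    let ?B = "(\<lambda>i. insert i T) ` (?A - T)"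
    have face: "G face_of P" "v \<in> G" "aff_dim G = aff_dim F - 1" "G \<subset> F"
      if G: "G \<in> facets_containing F {v}" for G
    proof -
      have "G facet_of F" "v \<in> G"
        using G by (auto simp: facets_containing_def)
      then show "G face_of P" "v \<in> G" "aff_dim G = aff_dim F - 1" "G \<subset> F"
        using face_of_trans[OF _ F(1)] facet_of_imp_subset[of G F] facet_of_irrefl[of F]
        by (auto simp: facet_of_def)
    qed
    have inB: "facets_containing P G \<in> ?B" if G: "G \<in> facets_containing F {v}" for G
    proof -
      let ?S = "facets_containing P G"
      have "T \<subset> ?S"
        using face_subset_iff_facets_containing[OF polyP] face[OF G] F(1-3) by blast
      then obtain i where i: "i \<in> ?S" "i \<notin> T" by blast
      have "int (card ?S) \<le> int (card T) + 1"
        using card_facets_containing_le_codim[OF simple v face(1,2)[OF G]] face(3)[OF G] F(4)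
        by linarith
      then have "insert i T = ?S"
        using \<open>T \<subset> ?S\<close> i insert.hyps(1) finite_facets_containing[OF polyP]
        by (intro card_seteq) auto
      moreover have "?S \<subseteq> ?A"
        using face(2)[OF G] by (auto simp: facets_containing_def)
      ultimately show ?thesis using i by blast
    qed
    have inj: "inj_on (facets_containing P) (facets_containing F {v})"
      by (rule inj_on_subset[OF inj_on_facets_containing[OF polyP]]) (use face in blast)
    have "inj_on (\<lambda>i. insert i T) (?A - T)"
      by (rule inj_onI) blast
    then have "card ?B = card ?A - card T"
      using insert by (simp add: card_image card_Diff_subset)
    moreover have "card T \<le> card ?A"
      using insert.prems finA by (simp add: card_mono)
    ultimately have "card ?B \<le> card (facets_containing P ` facets_containing F {v})"
      using many F(4) card_facets_through_simple_vertex[OF simple v] card_image[OF inj]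
      by linarith
    then have "facets_containing P ` facets_containing F {v} = ?B"
      using inB finA by (intro card_seteq) auto
    then have "insert g T \<in> facets_containing P ` facets_containing F {v}"
      using insert.hyps insert.prems by auto
    then obtain G where G: "insert g T = facets_containing P G" "G \<in> facets_containing F {v}"
      by (rule imageE)
    then show ?case
      using face(1-3)[OF G(2)] F(4) insert.hyps
      by (intro exI[of _ G]) (simp flip: G(1))
  qed
qed

lemma card_facets_containing_eq_codim:
  assumes simple: "simple_polytope P" and v: "v \<in> vertices P" and F: "F face_of P" "v \<in> F"
  shows "int (card (facets_containing P F)) = aff_dim P - aff_dim F"
proof -
  have "facets_containing P F \<subseteq> facets_containing P {v}"
    using F(2) by (auto simp: facets_containing_def)
  then obtain F' where F': "F' face_of P" "v \<in> F'" "facets_containing P F' = facets_containing P F"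
      "aff_dim F' = aff_dim P - int (card (facets_containing P F))"
    using facets_through_simple_vertex_span_face[OF simple v] by blast
  moreover have "F' = F"
    using simple F F'(1-3)
    by (intro inj_onD[OF inj_on_facets_containing[of P]]) (auto simp: simple_polytope_def)
  ultimately show ?thesis by simp
qed

text \<open>This is the Boolean structure of the face lattice above a simple vertex.\<close>

lemma bij_betw_faces_through_simple_vertex:
  assumes simple: "simple_polytope P" and v: "v \<in> vertices P" 
    and d: "aff_dim P = int d" and r: "r \<le> d"
  shows "bij_betw (facets_containing P) {F. F face_of P \<and> aff_dim F = int r \<and> v \<in> F}
           {T. T \<subseteq> facets_containing P {v} \<and> card T = d - r}"
    (is "bij_betw _ ?F ?T")
proof (rule bij_betw_imageI)
  show "inj_on (facets_containing P) ?F"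
    using simple
    by (intro inj_on_subset[OF inj_on_facets_containing[of P]]) (auto simp: simple_polytope_def)
  have "facets_containing P F \<in> ?T" if "F \<in> ?F" for F
    using that card_facets_containing_eq_codim[OF simple v, of F] d
    by (auto simp: facets_containing_def)
  moreover have "T \<in> facets_containing P ` ?F" if "T \<in> ?T" for T
    using facets_through_simple_vertex_span_face[OF simple v, of T] that d r by auto
  ultimately show "facets_containing P ` ?F = ?T" by blast
qed

lemma card_faces_through_simple_vertex:
  assumes simple: "simple_polytope P" and v: "v \<in> vertices P"
    and d: "aff_dim P = int d" and r: "r \<le> d"
  shows "card {F. F face_of P \<and> aff_dim F = int r \<and> v \<in> F} = d choose r"
proof -
  have "card {F. F face_of P \<and> aff_dim F = int r \<and> v \<in> F} = card (facets_containing P {v}) choose (d - r)"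
    using bij_betw_same_card[OF bij_betw_faces_through_simple_vertex[OF assms]] simple
    by (simp add: n_subsets finite_facets_containing simple_polytope_def)
  then show ?thesis
    using card_facets_through_simple_vertex[OF simple v] d r binomial_symmetric[OF r] by simp
qed

text \<open>An edge at \<open>v\<close> lies in all facets through \<open>v\<close> except one. A face through \<open>v\<close> avoids that edge as soon
  as the missing facet contains the face. Count faces by the \<open>r\<close> facets through \<open>v\<close> that do not contain
  them: these may be chosen freely among the facets that are missing for no neighbour in \<open>W\<close>.\<close>

lemma card_faces_through_simple_vertex_avoiding:
  assumes simple: "simple_polytope P" and v: "v \<in> vertices P"
    and d: "aff_dim P = int d" and r: "r \<le> d"
    and W: "finite W" "\<And>w. w \<in> W \<Longrightarrow> (v, w) \<in> vertex_edge_graph P"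
  shows "(d - card W) choose r
           \<le> card {F. F face_of P \<and> aff_dim F = int r \<and> v \<in> F \<and> F \<inter> W = {}}"
    (is "_ \<le> card ?X")
proof -
  have polyP: "polytope P" using simple by (simp add: simple_polytope_def)
  let ?A = "facets_containing P {v}"
  have finA: "finite ?A" using finite_facets_containing[OF polyP] .
  have cardA: "card ?A = d"
    using card_facets_through_simple_vertex[OF simple v] d by simp
  have "\<exists>i. i \<in> ?A - facets_containing P (closed_segment v w)" if "w \<in> W" for w
  proof -
    have "closed_segment v w face_of P" "aff_dim (closed_segment v w) = 1"
      using W(2)[OF that] by (auto simp: vertex_edge_graph_def edge_of_def)
    then have "card (facets_containing P (closed_segment v w)) < card ?A"
      using card_facets_containing_eq_codim[OF simple v, of "closed_segment v w"] d cardA by simp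
    then show ?thesis
      using card_mono[OF finite_facets_containing[OF polyP]] by (metis Diff_eq_empty_iff ex_in_conv leD)
  qed
  then obtain i where i: "\<And>w. w \<in> W \<Longrightarrow> i w \<in> ?A - facets_containing P (closed_segment v w)"
    by metis
  have avoid: "w \<notin> F" if F: "F face_of P" "v \<in> F" and w: "w \<in> W" "i w \<in> facets_containing P F" for F w
  proof
    assume "w \<in> F"
    then have "closed_segment v w \<subseteq> F"
      using F closed_segment_subset face_of_imp_convex polytope_imp_convex[OF polyP] by metis
    then show False using i[OF w(1)] w(2) by (auto simp: facets_containing_def)
  qed
  have finX: "finite ?X"
    by (rule finite_subset[OF _ finite_polytope_faces[OF polyP]]) auto
  have "{U. U \<subseteq> ?A - i ` W \<and> card U = r} \<subseteq> (\<lambda>F. ?A - facets_containing P F) ` ?X"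
  proof
    fix U assume "U \<in> {U. U \<subseteq> ?A - i ` W \<and> card U = r}"
    then have U: "U \<subseteq> ?A" "U \<inter> i ` W = {}" "card U = r" by auto
    have "card (?A - U) = d - r"
      using U finA cardA by (simp add: card_Diff_subset finite_subset)
    then have "?A - U \<in> facets_containing P ` {F. F face_of P \<and> aff_dim F = int r \<and> v \<in> F}"
      using bij_betw_imp_surj_on[OF bij_betw_faces_through_simple_vertex[OF simple v d r]] by auto
    then obtain F where F: "?A - U = facets_containing P F"
        "F \<in> {F. F face_of P \<and> aff_dim F = int r \<and> v \<in> F}"
      by (rule imageE)
    then have F: "F face_of P" "aff_dim F = int r" "v \<in> F" "facets_containing P F = ?A - U"
      by auto
    have "F \<inter> W = {}"
      using avoid[OF F(1,3)] F(4) i U(2) by blast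
    moreover have "U = ?A - facets_containing P F" using F(4) U(1) by blast
    ultimately show "U \<in> (\<lambda>F. ?A - facets_containing P F) ` ?X" using F by blast
  qed
  then have "card {U. U \<subseteq> ?A - i ` W \<and> card U = r} \<le> card ?X"
    by (rule surj_card_le[OF finX])
  then have le: "card (?A - i ` W) choose r \<le> card ?X"
    using finA by (simp add: n_subsets)
  have "card (?A - i ` W) = d - card (i ` W)"
    using i W(1) cardA by (subst card_Diff_subset) auto
  then have "d - card W \<le> card (?A - i ` W)"
    using card_image_le[OF W(1), of i] by simp
  then show ?thesis
    using binomial_right_mono[of "d - card W" "card (?A - i ` W)" r] le by linarith
qed

section \<open>Vertices of small out-degree in unique sink orientations\<close>

lemma finite_vertices: "polytope P \<Longrightarrow> finite (vertices P)"
  unfolding vertices_def by (rule finite_polyhedron_extreme_points[OF polytope_imp_polyhedron])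

lemma vertices_face: "F face_of P \<Longrightarrow> vertices F = vertices P \<inter> F"
  by (auto simp: vertices_def extreme_point_of_face)

lemma aff_dim_less_card_vertices:
  assumes "polytope F"
  shows "aff_dim F < int (card (vertices F))"
proof -
  have "F = convex hull (vertices F)"
    unfolding vertices_def
    using Krein_Milman_Minkowski polytope_imp_compact polytope_imp_convex assms by blast
  then show ?thesis
    using aff_dim_le_card[OF finite_vertices[OF assms]] aff_dim_convex_hull[of "vertices F"] by simp
qed

text \<open>Count the \<open>r\<close>-dimensional faces twice. A face has at least \<open>r + 1\<close> vertices and a vertex lies in
  \<open>d choose r\<close> faces, which bounds the number of faces from above. A vertex of out-degree at most \<open>k\<close>
  is the sink of every face that avoids its out-neighbours, of which there are
  \<open>(d - k) choose r\<close> or more; sinks are unique, so these faces are distinct for distinct vertices.\<close>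

lemma count_small_outdegree_vertices:
  assumes simple: "simple_polytope P" and auso: "auso P D"
    and d: "aff_dim P = int d" and r: "r \<le> d"
  shows "(r + 1) * (card {v \<in> vertices P. card (D `` {v}) \<le> k} * ((d - k) choose r))
           \<le> card (vertices P) * (d choose r)"
proof -
  have polyP: "polytope P" using simple by (simp add: simple_polytope_def)
  have finV: "finite (vertices P)" using finite_vertices[OF polyP] .
  define L where "L = {v \<in> vertices P. card (D `` {v}) \<le> k}"
  have finL: "finite L" using finV by (simp add: L_def)
  define Fs where "Fs = {F. F face_of P \<and> aff_dim F = int r}"
  have finFs: "finite Fs"
    unfolding Fs_def by (rule finite_subset[OF _ finite_polytope_faces[OF polyP]]) auto
  have edges: "D \<subseteq> vertex_edge_graph P"
    using auso by (auto simp: auso_def)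

  have "(r + 1) * card Fs = (\<Sum>F\<in>Fs. r + 1)" by simp
  also have "\<dots> \<le> (\<Sum>F\<in>Fs. card {v \<in> vertices P. v \<in> F})"
  proof (rule sum_mono)
    fix F assume "F \<in> Fs"
    then have F: "F face_of P" "aff_dim F = int r" by (auto simp: Fs_def)
    have "{v \<in> vertices P. v \<in> F} = vertices F" using vertices_face[OF F(1)] by auto
    then show "r + 1 \<le> card {v \<in> vertices P. v \<in> F}"
      using aff_dim_less_card_vertices[OF face_of_polytope_polytope[OF polyP F(1)]] F(2) by simp
  qed
  also have "\<dots> = (d choose r) * card (vertices P)"
    using card_faces_through_simple_vertex[OF simple _ d r]
    by (intro sum_multicount[OF finFs finV]) (auto simp: Fs_def conj_assoc)
  finally have upper: "(r + 1) * card Fs \<le> card (vertices P) * (d choose r)"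
    by (simp add: mult.commute)

  have "card L * ((d - k) choose r) = (\<Sum>v\<in>L. (d - k) choose r)" by simp
  also have "\<dots> \<le> (\<Sum>v\<in>L. card {F \<in> Fs. is_sink D (vertices F) v})"
  proof (rule sum_mono)
    fix v assume "v \<in> L"
    then have v: "v \<in> vertices P" "card (D `` {v}) \<le> k" by (auto simp: L_def)
    have "D `` {v} \<subseteq> vertices P"
      using edges by (auto simp: vertex_edge_graph_def)
    then have "finite (D `` {v})" using finV finite_subset by blast
    then have "(d - card (D `` {v})) choose r
        \<le> card {F. F face_of P \<and> aff_dim F = int r \<and> v \<in> F \<and> F \<inter> D `` {v} = {}}"
      using card_faces_through_simple_vertex_avoiding[OF simple v(1) d r] edges by blast
    also have "\<dots> \<le> card {F \<in> Fs. is_sink D (vertices F) v}"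
      using finFs v(1) vertices_face
      by (intro card_mono) (fastforce simp: Fs_def is_sink_def)+
    finally show "(d - k) choose r \<le> card {F \<in> Fs. is_sink D (vertices F) v}"
      using binomial_right_mono[of "d - k" "d - card (D `` {v})" r] v(2) by linarith
  qed
  also have "\<dots> = (\<Sum>F\<in>Fs. card {v \<in> L. is_sink D (vertices F) v})"
    using sum_multicount_gen[OF finL finFs, of "\<lambda>v F. is_sink D (vertices F) v"] by simp
  also have "\<dots> \<le> (\<Sum>F\<in>Fs. 1)"
  proof (rule sum_mono)
    fix F assume "F \<in> Fs"
    then have "F face_of P" "F \<noteq> {}" by (auto simp: Fs_def)
    then have "\<exists>!v. is_sink D (vertices F) v"
      using auso by (simp add: auso_def)
    then obtain t where "{v \<in> L. is_sink D (vertices F) v} \<subseteq> {t}" by blast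
    then show "card {v \<in> L. is_sink D (vertices F) v} \<le> 1"
      using card_mono[of "{t}"] by fastforce
  qed
  finally have "card L * ((d - k) choose r) \<le> card Fs" by simp
  then show ?thesis
    using upper mult_le_mono2 order_trans unfolding L_def by blast
qed

text \<open>Of all \<open>r\<close>-subsets of a \<open>d\<close>-set a fraction \<open>r / d\<close> contains a given point, so by the union bound
  at least half of them miss \<open>k\<close> given points. The proof removes these points one by one.\<close>

lemma binomial_le_twice_binomial_diff:
  assumes "2 * (k * r) \<le> d"
  shows "d choose r \<le> 2 * ((d - k) choose r)"
proof -
  have drop: "d * (d choose r) \<le> d * ((d - j) choose r) + j * r * (d choose r)" for j
  proof (induction j)
    case (Suc j)
    have "d * ((d - j) choose r) \<le> d * ((d - Suc j) choose r) + r * (d choose r)"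
    proof (cases "r = 0 \<or> d \<le> j")
      case False
      then obtain q e where q: "r = Suc q" and e: "d - j = Suc e" "d - Suc j = e"
        by (cases r; cases "d - j") auto
      have "d * (e choose q) \<le> d * ((d - 1) choose q)"
        using e by (intro mult_le_mono2 binomial_right_mono) linarith
      also have "\<dots> = r * (d choose r)"
        using False q times_binomial_minus1_eq[of r d] by simp
      finally show ?thesis
        using q e by (simp add: algebra_simps)
    qed auto
    then show ?case using Suc by (simp add: algebra_simps)
  qed simp
  show ?thesis
  proof (cases "d = 0")
    case False
    have "2 * (k * r * (d choose r)) \<le> d * (d choose r)"
      using mult_le_mono1[OF assms, of "d choose r"] by (simp add: mult.assoc)
    then have "d * (d choose r) \<le> d * (2 * ((d - k) choose r))"
      using drop[of k] by linarith
    then show ?thesis using False by simp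
  qed simp
qed

lemma card_small_outdegree_vertices_le:
  assumes "simple_polytope P" "auso P D" "aff_dim P = int d" "2 * (k * k) \<le> d"
  shows "(k + 1) * card {v \<in> vertices P. card (D `` {v}) \<le> k} \<le> 2 * card (vertices P)"
proof -
  let ?L = "card {v \<in> vertices P. card (D `` {v}) \<le> k}"
  have "k \<le> k * k" by simp
  then have k: "k \<le> d" using assms(4) by linarith
  have "(k + 1) * (?L * (d choose k)) \<le> (k + 1) * (?L * (2 * ((d - k) choose k)))"
    using binomial_le_twice_binomial_diff[OF assms(4)] by (intro mult_le_mono2)
  also have "\<dots> = 2 * ((k + 1) * (?L * ((d - k) choose k)))" by (simp add: algebra_simps)
  also have "\<dots> \<le> 2 * (card (vertices P) * (d choose k))"
    using count_small_outdegree_vertices[OF assms(1-3) k, of k] by simp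
  finally have "((k + 1) * ?L) * (d choose k) \<le> (2 * card (vertices P)) * (d choose k)"
    by (simp add: algebra_simps)
  then show ?thesis using k by (simp add: zero_less_binomial)
qed

section \<open>The bound for simple polytopes\<close>

theorem theorem1:
  fixes P :: "'a::euclidean_space set" and \<phi> :: "'a \<Rightarrow> real" and s :: 'a and d n :: nat
  assumes "simple_polytope P"
    and "aff_dim P = int d" and "d \<ge> 1"
    and "card (vertices P) = n" and "n \<ge> d + 1"
    and "abstract_objective_function P \<phi>"
    and "s \<in> vertices P"
  shows "(\<integral>\<^sup>+ p. of_nat (length p) \<partial>measure_spmf (random_edge_path (induced_orientation P \<phi>) s))
           \<le> ennreal (13 * (real n / sqrt (real d)))"
proof -
  let ?D = "induced_orientation P \<phi>"
  define k where "k = nat \<lfloor>sqrt (real d / 2)\<rfloor>"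
  have k: "real k \<le> sqrt (real d / 2)" "sqrt (real d / 2) < real k + 1"
    unfolding k_def by (auto simp: of_nat_nat)
  have "(real k)\<^sup>2 \<le> (sqrt (real d / 2))\<^sup>2"
    using k(1) by (intro power_mono) auto
  then have "real (2 * (k * k)) \<le> real d"
    by (simp add: power2_eq_square)
  then have kk: "2 * (k * k) \<le> d"
    by linarith
  have "sqrt (real d) = sqrt 2 * sqrt (real d / 2)"
    by (simp flip: real_sqrt_mult)
  also have "\<dots> \<le> 2 * (real k + 1)"
    using k(2) sqrt2_less_2 by (intro mult_mono) auto
  finally have sqrt_d: "sqrt (real d) \<le> 2 * (real k + 1)" .

  let ?L = "{v \<in> vertices P. card (?D `` {v}) \<le> k}"
  have "auso P ?D"
    using assms(6) by (simp add: abstract_objective_function_def)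
  then have "(k + 1) * card ?L \<le> 2 * n"
    using card_small_outdegree_vertices_le[OF assms(1) _ assms(2) kk] assms(4) by simp
  then have "real ((k + 1) * card ?L) \<le> real (2 * n)"
    by (rule of_nat_mono)
  then have few: "real (card ?L) \<le> 2 * real n / (real k + 1)"
    by (simp add: field_simps)

  have finV: "finite (vertices P)"
    using finite_vertices assms(1) by (auto simp: simple_polytope_def)
  have arcs: "?D \<subseteq> vertices P \<times> vertices P"
    by (auto simp: induced_orientation_def vertex_edge_graph_def)
  have descent: "\<phi> w < \<phi> v" if "(v, w) \<in> ?D" for v w
    using that by (simp add: induced_orientation_def)
  have "expected_visits ?D s \<le> ennreal (real (card ?L) + 2 * real n / real (k + 2))"
    using expected_visits_le_of_few_small_outdegrees[where \<phi> = \<phi>, OF finV arcs descent assms(7)]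
    unfolding assms(4) .
  also have "real (card ?L) + 2 * real n / real (k + 2) \<le> 13 * (real n / sqrt (real d))"
  proof -
    have rescale: "2 * x / c + 2 * x / c = 8 * (x / (2 * c))" for x c :: real
      by simp
    have "2 * real n / real (k + 2) \<le> 2 * real n / (real k + 1)"
      by (intro divide_left_mono) auto
    then have "real (card ?L) + 2 * real n / real (k + 2)
        \<le> 2 * real n / (real k + 1) + 2 * real n / (real k + 1)"
      using few by linarith
    also have "\<dots> = 8 * (real n / (2 * (real k + 1)))"
      by (rule rescale)
    also have "\<dots> \<le> 13 * (real n / sqrt (real d))"
      using sqrt_d assms(3) by (intro mult_mono divide_left_mono) auto
    finally show ?thesis .
  qed
  finally show ?thesis
    by (simp add: ennreal_leI)
qed

end
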